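(* Let $n\geq 4$ be an even integer, let $\mathbb{D}_{2n}=\langle a,b \mid a^n=b^2=1,\ ba=a^{n-1}b\rangle$, let $\Psi=\{ab, a^{2}b, \dots , a^{n-1}b, b\}\cup\{a^{n/2}\}$, and let $\Lambda=\mathrm{Cay}(\mathbb{D}_{2n}, \Psi)$. Then the strong metric dimension of $\Lambda$ is $2n-2$.
   Context: For a finite group $G$ and an inverse-closed subset $Q\subseteq G\setminus\{1\}$, the Cayley graph $\mathrm{Cay}(G,Q)$ has vertex set $G$ and edge set $\{\{x,y\} : x^{-1}y\in Q\}$. In a connected graph $\Gamma$, a vertex $w$ strongly resolves vertices $u,v$ if $u$ lies on some shortest $v$–$w$ path or $v$ lies on some shortest $u$–$w$ path. A set $S$ of vertices is a strong resolving set if every two distinct vertices of $\Gamma$ are strongly resolved by some vertex of $S$. The strong metric dimension $\mathrm{sdim}(\Gamma)$ is the minimum cardinality of a strong resolving set. *)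

theory Defs
  imports "HOL-Algebra.Group" "Graph_Theory.Pair_Digraph" "Graph_Theory.Vertex_Walk"
begin

section \<open>Groups given by generators and relations\<close>

text \<open>
  A letter \<open>(g, True)\<close> stands for the generator \<open>g\<close> and \<open>(g, False)\<close> for its formal inverse.
  A relation \<open>u = v\<close> between words is a pair \<open>(u, v)\<close>. All elements of the type \<open>'g\<close> are generators.
\<close>

type_synonym 'g word = "('g \<times> bool) list"

inductive pres_eq :: "('g word \<times> 'g word) set \<Rightarrow> 'g word \<Rightarrow> 'g word \<Rightarrow> bool"
  for R where
  relation: "(u, v) \<in> R \<Longrightarrow> pres_eq R u v"
| cancel: "pres_eq R [(g, e), (g, \<not> e)] []"
| congr: "pres_eq R u v \<Longrightarrow> pres_eq R (x @ u @ y) (x @ v @ y)"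
| refl: "pres_eq R u u"
| sym: "pres_eq R u v \<Longrightarrow> pres_eq R v u"
| trans: "pres_eq R u v \<Longrightarrow> pres_eq R v w \<Longrightarrow> pres_eq R u w"

definition pres_rel :: "('g word \<times> 'g word) set \<Rightarrow> ('g word \<times> 'g word) set" where
  "pres_rel R = {(u, v). pres_eq R u v}"

definition pres_class :: "('g word \<times> 'g word) set \<Rightarrow> 'g word \<Rightarrow> 'g word set" where
  "pres_class R u = pres_rel R `` {u}"

definition presented_group :: "('g word \<times> 'g word) set \<Rightarrow> 'g word set monoid" where
  "presented_group R =
     \<lparr>carrier = UNIV // pres_rel R,
      monoid.mult = (\<lambda>A B. \<Union>u\<in>A. \<Union>v\<in>B. pres_class R (u @ v)),
      one = pres_class R []\<rparr>"

lemma equiv_pres_rel: "equiv UNIV (pres_rel R)"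
  by (intro equivI refl_onI symI transI)
     (auto simp: pres_rel_def intro: pres_eq.refl pres_eq.sym pres_eq.trans)

lemma pres_class_eq_iff: "pres_class R u = pres_class R v \<longleftrightarrow> pres_eq R u v"
  using eq_equiv_class_iff[OF equiv_pres_rel, of u v R]
  by (simp add: pres_class_def pres_rel_def)

lemma pres_eq_append:
  assumes "pres_eq R u u'" "pres_eq R v v'"
  shows "pres_eq R (u @ v) (u' @ v')"
  using pres_eq.congr[OF assms(1), of "[]" v] pres_eq.congr[OF assms(2), of u' "[]"]
  by (auto intro: pres_eq.trans)

lemma carrier_presented_group: "carrier (presented_group R) = range (pres_class R)"
  by (auto simp: presented_group_def pres_class_def quotient_def)

lemma one_presented_group: "\<one>\<^bsub>presented_group R\<^esub> = pres_class R []"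
  by (simp add: presented_group_def)

lemma mult_presented_group:
  "pres_class R u \<otimes>\<^bsub>presented_group R\<^esub> pres_class R v = pres_class R (u @ v)"
proof -
  have *: "pres_class R (u' @ v') = pres_class R (u @ v)"
    if "u' \<in> pres_class R u" "v' \<in> pres_class R v" for u' v'
  proof -
    have "pres_eq R u u'" "pres_eq R v v'"
      using that by (auto simp: pres_class_def pres_rel_def)
    then show ?thesis
      by (simp add: pres_class_eq_iff pres_eq_append pres_eq.sym)
  qed
  have ne: "w \<in> pres_class R w" for w
    by (simp add: pres_class_def pres_rel_def pres_eq.refl)
  have "(\<Union>u'\<in>pres_class R u. \<Union>v'\<in>pres_class R v. pres_class R (u' @ v')) =
        (\<Union>u'\<in>pres_class R u. \<Union>v'\<in>pres_class R v. pres_class R (u @ v))"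
    by (intro SUP_cong HOL.refl *)
  also have "\<dots> = pres_class R (u @ v)"
    using ne[of u] ne[of v] by auto
  finally show ?thesis
    by (simp add: presented_group_def)
qed

lemma pres_eq_left_inverse: "\<exists>v. pres_eq R (v @ u) []"
proof (induction u)
  case Nil
  show ?case by (auto intro: exI[of _ "[]"] pres_eq.refl)
next
  case (Cons l u)
  obtain g e where l: "l = (g, e)" by force
  from Cons obtain v where v: "pres_eq R (v @ u) []" by blast
  have "pres_eq R (v @ [(g, \<not> e), (g, \<not> \<not> e)] @ u) (v @ [] @ u)"
    by (intro pres_eq.congr pres_eq.cancel)
  with v have "pres_eq R ((v @ [(g, \<not> e)]) @ l # u) []"
    by (auto simp: l intro: pres_eq.trans)
  then show ?case by blast
qed

lemma group_presented_group: "group (presented_group R)"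
proof (rule groupI)
  fix x assume "x \<in> carrier (presented_group R)"
  then obtain u where u: "x = pres_class R u" by (auto simp: carrier_presented_group)
  obtain v where "pres_eq R (v @ u) []" using pres_eq_left_inverse by blast
  then show "\<exists>y\<in>carrier (presented_group R). y \<otimes>\<^bsub>presented_group R\<^esub> x = \<one>\<^bsub>presented_group R\<^esub>"
    by (intro bexI[of _ "pres_class R v"])
       (auto simp: u carrier_presented_group one_presented_group mult_presented_group pres_class_eq_iff)
qed (auto simp: carrier_presented_group one_presented_group mult_presented_group)


section \<open>Dihedral groups\<close>

datatype dihedral_gen = Gen_a | Gen_b

abbreviation word_a :: "dihedral_gen word" where "word_a \<equiv> [(Gen_a, True)]"
abbreviation word_b :: "dihedral_gen word" where "word_b \<equiv> [(Gen_b, True)]"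

definition dihedral_relations :: "nat \<Rightarrow> (dihedral_gen word \<times> dihedral_gen word) set" where
  "dihedral_relations n =
     {(concat (replicate n word_a), []),
      (word_b @ word_b, []),
      (word_b @ word_a, concat (replicate (n - 1) word_a) @ word_b)}"

definition dihedral :: "nat \<Rightarrow> dihedral_gen word set monoid" where
  "dihedral n = presented_group (dihedral_relations n)"

definition dihedral_a :: "nat \<Rightarrow> dihedral_gen word set" where
  "dihedral_a n = pres_class (dihedral_relations n) word_a"

definition dihedral_b :: "nat \<Rightarrow> dihedral_gen word set" where
  "dihedral_b n = pres_class (dihedral_relations n) word_b"


section \<open>Cayley graphs\<close>

text \<open>
  As usual in \<^theory>\<open>Graph_Theory.Pair_Digraph\<close>, an undirected edge \<open>{x, y}\<close> is represented by the
  two arcs \<open>(x, y)\<close> and \<open>(y, x)\<close>. The lemma below shows that this is a finite simple graph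
  under the standing assumptions on \<open>Q\<close>.
\<close>

definition cayley_graph :: "('a, 'm) monoid_scheme \<Rightarrow> 'a set \<Rightarrow> 'a pair_pre_digraph" where
  "cayley_graph G Q =
     \<lparr>pverts = carrier G,
      parcs = {(x, y). x \<in> carrier G \<and> y \<in> carrier G \<and> inv\<^bsub>G\<^esub> x \<otimes>\<^bsub>G\<^esub> y \<in> Q}\<rparr>"

lemma pair_graph_cayley_graph:
  assumes "group G" "finite (carrier G)" "Q \<subseteq> carrier G - {\<one>\<^bsub>G\<^esub>}"
    and inverse_closed: "\<And>q. q \<in> Q \<Longrightarrow> inv\<^bsub>G\<^esub> q \<in> Q"
  shows "pair_graph (cayley_graph G Q)"
proof -
  interpret group G by fact
  have "inv\<^bsub>G\<^esub> y \<otimes>\<^bsub>G\<^esub> x \<in> Q"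
    if "x \<in> carrier G" "y \<in> carrier G" "inv\<^bsub>G\<^esub> x \<otimes>\<^bsub>G\<^esub> y \<in> Q" for x y
    using inverse_closed[OF that(3)] that by (simp add: inv_mult_group)
  then have "sym (parcs (cayley_graph G Q))"
    by (auto simp: cayley_graph_def sym_def)
  moreover have "finite (parcs (cayley_graph G Q))"
    by (rule finite_subset[of _ "carrier G \<times> carrier G"])
       (auto simp: cayley_graph_def assms(2))
  ultimately show ?thesis
    using assms(2,3) by unfold_locales (auto simp: cayley_graph_def symmetric_def)
qed


section \<open>Strong metric dimension\<close>

definition shortest_vpath :: "('a, 'b) pre_digraph \<Rightarrow> 'a \<Rightarrow> 'a list \<Rightarrow> 'a \<Rightarrow> bool" where
  "shortest_vpath \<Gamma> u p v \<longleftrightarrow>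
     vpath p \<Gamma> \<and> hd p = u \<and> last p = v \<and>
     (\<forall>q. vpath q \<Gamma> \<and> hd q = u \<and> last q = v \<longrightarrow> vwalk_length p \<le> vwalk_length q)"

definition strongly_resolves :: "('a, 'b) pre_digraph \<Rightarrow> 'a \<Rightarrow> 'a \<Rightarrow> 'a \<Rightarrow> bool" where
  "strongly_resolves \<Gamma> w u v \<longleftrightarrow>
     (\<exists>p. shortest_vpath \<Gamma> v p w \<and> u \<in> set p) \<or> (\<exists>p. shortest_vpath \<Gamma> u p w \<and> v \<in> set p)"

definition strong_resolving_set :: "('a, 'b) pre_digraph \<Rightarrow> 'a set \<Rightarrow> bool" where
  "strong_resolving_set \<Gamma> S \<longleftrightarrow>
     S \<subseteq> verts \<Gamma> \<and>
     (\<forall>u\<in>verts \<Gamma>. \<forall>v\<in>verts \<Gamma>. u \<noteq> v \<longrightarrow> (\<exists>w\<in>S. strongly_resolves \<Gamma> w u v))"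

text \<open>
  Meaningful for a finite connected graph, where the set of all vertices is a strong resolving set.
  Finiteness of \<open>S\<close> is required because \<^const>\<open>card\<close> is \<open>0\<close> on infinite sets.
\<close>

definition sdim :: "('a, 'b) pre_digraph \<Rightarrow> nat" where
  "sdim \<Gamma> = (LEAST k. \<exists>S. finite S \<and> strong_resolving_set \<Gamma> S \<and> card S = k)"


section \<open>The connection set\<close>

definition Psi :: "nat \<Rightarrow> dihedral_gen word set set" where
  "Psi n =
     {dihedral_a n [^]\<^bsub>dihedral n\<^esub> i \<otimes>\<^bsub>dihedral n\<^esub> dihedral_b n |i::nat. 1 \<le> i \<and> i \<le> n - 1} \<union>
     {dihedral_b n} \<union> {dihedral_a n [^]\<^bsub>dihedral n\<^esub> (n div 2)}"

end

theory Submission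
  imports Defs
begin

text \<open>
  Since \<open>\<Psi>\<close> consists of all reflections and the involution \<open>a\<^sup>m\<close>, \<open>m = n/2\<close>, the graph is the join of two
  perfect matchings \<open>x \<mapsto> x a\<^sup>m\<close>, one on the \<open>n\<close> rotations and one on the \<open>n\<close> reflections. Two vertices on
  the same side are either matched, hence twins, or at distance 2, the diameter; in both cases they
  are strongly resolved only by themselves, so a strong resolving set misses at most one vertex on each
  side. Conversely, if exactly one vertex is omitted on each side, the two omitted vertices \<open>u\<close>, \<open>v\<close> are
  resolved by any \<open>w\<close> on the side of \<open>u\<close> that is not adjacent to \<open>u\<close>, through the path \<open>u, v, w\<close>.
\<close>

section \<open>Joins of two matchings\<close>

text \<open>Three vertices per side leave one that differs from a given vertex and from its mate;
  the pair omitted from a resolving set is resolved by such a vertex. Since \<open>mate\<close> is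
  an involution, two successive mate arcs lead back to the start.\<close>

locale matching_join =
  fixes G :: "'a pair_pre_digraph" and side :: "'a \<Rightarrow> bool" and mate :: "'a \<Rightarrow> 'a"
  assumes finite_verts: "finite (pverts G)"
    and arc_iff: "\<And>x y. x \<in> pverts G \<Longrightarrow> y \<in> pverts G \<Longrightarrow>
      (x, y) \<in> parcs G \<longleftrightarrow> side x \<noteq> side y \<or> y = mate x"
    and mate_mate: "\<And>x. x \<in> pverts G \<Longrightarrow> mate (mate x) = x"
    and card_side: "\<And>s. card {x \<in> pverts G. side x = s} \<ge> 3"
begin

section \<open>Distances and strong resolution in the join\<close>

lemma exists_on_side_avoiding:
  "\<exists>w \<in> pverts G. side w = s \<and> w \<noteq> x \<and> w \<noteq> y"
proof (rule ccontr)
  assume "\<not> ?thesis"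
  then have "{w \<in> pverts G. side w = s} \<subseteq> {x, y}" by auto
  then have "card {w \<in> pverts G. side w = s} \<le> card {x, y}"
    by (intro card_mono) auto
  also have "\<dots> \<le> 2" by (cases "x = y") auto
  finally show False using card_side[of s] by simp
qed

text \<open>Nonadjacent distinct vertices are on the same side, so any vertex of the opposite side
  is a common neighbour. The bound 3 counts vertices: the diameter is at most 2.\<close>

lemma short_vpath:
  assumes "u \<in> pverts G" "v \<in> pverts G"
  shows "\<exists>p. vpath p G \<and> hd p = u \<and> last p = v \<and> length p \<le> 3"
proof -
  consider "u = v" | "u \<noteq> v" "(u, v) \<in> parcs G" | "u \<noteq> v" "(u, v) \<notin> parcs G" by blast
  then show ?thesis
  proof cases
    case 1
    with assms show ?thesis by (intro exI[of _ "[u]"]) (auto simp: vpath_def vwalk_def)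
  next
    case 2
    with assms show ?thesis by (intro exI[of _ "[u, v]"]) (auto simp: vpath_def vwalk_def)
  next
    case 3
    with assms have same: "side u = side v" by (auto simp: arc_iff)
    obtain x where "x \<in> pverts G" "side x = (\<not> side u)"
      using exists_on_side_avoiding by blast
    with 3 assms same show ?thesis
      by (intro exI[of _ "[u, x, v]"]) (auto simp: vpath_def vwalk_def arc_iff)
  qed
qed

lemma shortest_vpath_exists:
  assumes "u \<in> pverts G" "v \<in> pverts G"
  shows "\<exists>p. shortest_vpath G u p v"
  using short_vpath[OF assms]
    ex_has_least_nat[of "\<lambda>p. vpath p G \<and> hd p = u \<and> last p = v" _ vwalk_length]
  unfolding shortest_vpath_def by blast

lemma strongly_resolves_self:
  assumes "u \<in> pverts G" "v \<in> pverts G"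
  shows "strongly_resolves G u u v" "strongly_resolves G v u v"
proof -
  obtain p where p: "shortest_vpath G v p u" using shortest_vpath_exists assms by blast
  then have "u \<in> set p" by (auto simp: shortest_vpath_def vpath_def vwalk_def)
  with p show "strongly_resolves G u u v" by (auto simp: strongly_resolves_def)
  obtain q where q: "shortest_vpath G u q v" using shortest_vpath_exists assms by blast
  then have "v \<in> set q" by (auto simp: shortest_vpath_def vpath_def vwalk_def)
  with q show "strongly_resolves G v u v" by (auto simp: strongly_resolves_def)
qed

text \<open>A shortest path with \<open>u\<close> inside must be \<open>v, u, w\<close>. If
  \<open>w\<close> were on the opposite side, the arc from \<open>v\<close> to \<open>w\<close>
  would be shorter. Otherwise both arcs of the path stay on one side, hence are mate arcs, and
  \<open>w = mate (mate v) = v\<close>.\<close>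

lemma no_shortest_vpath_through_same_side:
  assumes p: "shortest_vpath G v p w" "u \<in> set p"
    and verts: "u \<in> pverts G" "v \<in> pverts G" "w \<in> pverts G"
    and "side u = side v" "u \<noteq> v" "w \<noteq> u" "w \<noteq> v"
  shows False
proof -
  have path: "set p \<subseteq> pverts G" "set (vwalk_arcs p) \<subseteq> parcs G" "p \<noteq> []" "distinct p"
    "hd p = v" "last p = w"
    using p by (auto simp: shortest_vpath_def vpath_def vwalk_def)
  have minimal: "length p - 1 \<le> length q - 1" if "vpath q G" "hd q = v" "last q = w" for q
    using p that by (auto simp: shortest_vpath_def)
  obtain q where "vpath q G" "hd q = v" "last q = w" "length q \<le> 3"
    using short_vpath verts by blast
  then have "length p \<le> 3" using minimal[of q] by simp
  \<comment> \<open>As \<open>u\<close> differs from both ends, it lies among the inner vertices,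
    and a path of at most three vertices has room for only one.\<close>
  have "\<exists>x. p = [v, x, w]"
  proof -
    obtain xs where xs: "p = v # xs" using path(3,5) by (cases p) auto
    with path(6) \<open>w \<noteq> v\<close> obtain ys where ys: "xs = ys @ [w]"
      by (cases xs rule: rev_cases) auto
    from p(2) xs ys assms(7,8) have "u \<in> set ys" by auto
    with xs ys \<open>length p \<le> 3\<close> show ?thesis by (cases ys) auto
  qed
  with p(2) assms(7,8) have eq: "p = [v, u, w]" by auto
  have "(v, w) \<notin> parcs G"
  proof
    assume "(v, w) \<in> parcs G"
    then have "vpath [v, w] G" using verts assms(9) by (auto simp: vpath_def vwalk_def)
    then show False using minimal[of "[v, w]"] eq by simp
  qed
  then have "side v = side w" using verts by (simp add: arc_iff)
  moreover have "(v, u) \<in> parcs G" "(u, w) \<in> parcs G" using path(2) eq by auto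
  ultimately have "u = mate v" "w = mate u" using verts assms(6) by (auto simp: arc_iff)
  then show False using mate_mate verts assms(9) by simp
qed

text \<open>Both disjuncts of \<open>strongly_resolves\<close> fall to the previous lemma, once with
  \<open>u\<close> and \<open>v\<close> exchanged. In terms of the strong resolving graph, each side
  is a clique.\<close>

lemma strongly_resolves_same_side:
  assumes "strongly_resolves G w u v" "u \<in> pverts G" "v \<in> pverts G" "w \<in> pverts G"
    and "side u = side v" "u \<noteq> v"
  shows "w = u \<or> w = v"
  using assms no_shortest_vpath_through_same_side[of v _ w u]
    no_shortest_vpath_through_same_side[of u _ w v]
  unfolding strongly_resolves_def by metis

text \<open>Here \<open>u\<close> and \<open>w\<close> are nonadjacent, hence at distance 2, and
  every vertex of the opposite side, \<open>v\<close> among them, is the middle of a shortest path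
  between them.\<close>

lemma strongly_resolves_other_side:
  assumes verts: "u \<in> pverts G" "v \<in> pverts G" "w \<in> pverts G"
    and sides: "side u \<noteq> side v" "side w = side u" "w \<noteq> u" "w \<noteq> mate u"
  shows "strongly_resolves G w u v"
proof -
  have nonadj: "(u, w) \<notin> parcs G" using assms by (auto simp: arc_iff)
  have path: "vpath [u, v, w] G" using assms by (auto simp: vpath_def vwalk_def arc_iff)
  have "length q \<ge> 3" if "vpath q G" "hd q = u" "last q = w" for q
  proof (rule ccontr)
    assume "\<not> length q \<ge> 3"
    \<comment> \<open>The case rule of \<open>remdups_adj\<close> serves only for its list patterns:
      empty, singleton, two or more entries. A singleton would force \<open>u = w\<close>, a pair
      the missing arc.\<close>
    then consider "q = []" | x where "q = [x]" | x y where "q = [x, y]"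
      by (cases q rule: remdups_adj.cases) (auto simp: Suc_le_eq)
    then show False using that nonadj sides by cases (auto simp: vpath_def vwalk_def)
  qed
  then have "vwalk_length [u, v, w] \<le> vwalk_length q" if "vpath q G" "hd q = u" "last q = w" for q
    using that by fastforce
  with path have "shortest_vpath G u [u, v, w] w" by (auto simp: shortest_vpath_def)
  then show ?thesis unfolding strongly_resolves_def by (intro disjI2 exI[of _ "[u, v, w]"]) simp
qed

section \<open>Lower and upper bound\<close>

lemma card_strong_resolving_set_ge:
  assumes S: "strong_resolving_set G S"
  shows "card S \<ge> card (pverts G) - 2"
proof -
  have sub: "S \<subseteq> pverts G" using S by (simp add: strong_resolving_set_def)
  \<comment> \<open>Two omitted vertices on one side could be resolved only by themselves. With
    \<open>side\<close> injective into \<open>bool\<close>, at most two vertices are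
    omitted.\<close>
  have inj: "inj_on side (pverts G - S)"
  proof (rule inj_onI, rule ccontr)
    fix u v assume uv: "u \<in> pverts G - S" "v \<in> pverts G - S" "side u = side v" "u \<noteq> v"
    then obtain w where "w \<in> S" "strongly_resolves G w u v"
      using S unfolding strong_resolving_set_def with_proj_simps by blast
    then show False using strongly_resolves_same_side[of w u v] uv sub by blast
  qed
  have "card (pverts G - S) \<le> card (UNIV :: bool set)"
    by (rule card_inj_on_le[OF inj]) auto
  moreover have "card (pverts G - S) = card (pverts G) - card S"
    using sub finite_verts by (simp add: card_Diff_subset finite_subset)
  ultimately show ?thesis by simp
qed

lemma strong_resolving_set_Diff:
  assumes "x \<in> pverts G" "y \<in> pverts G" "side x \<noteq> side y"
  shows "strong_resolving_set G (pverts G - {x, y})"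
  unfolding strong_resolving_set_def
proof (intro conjI ballI impI)
  fix u v assume uv: "u \<in> verts G" "v \<in> verts G" "u \<noteq> v"
  show "\<exists>w\<in>pverts G - {x, y}. strongly_resolves G w u v"
  proof (cases "u \<in> {x, y} \<and> v \<in> {x, y}")
    case True
    \<comment> \<open>Such a \<open>w\<close> is not omitted: it is not \<open>u\<close>, and the
      other omitted vertex is on the opposite side. Every other pair has a member in the set, which
      resolves the pair itself.\<close>
    obtain w where w: "w \<in> pverts G" "side w = side u" "w \<noteq> u" "w \<noteq> mate u"
      using exists_on_side_avoiding by blast
    with True uv assms have "w \<in> pverts G - {x, y}" "side u \<noteq> side v" by auto
    with w uv strongly_resolves_other_side[of u v w] show ?thesis by auto
  next
    case False
    with uv strongly_resolves_self[of u v] show ?thesis by auto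
  qed
qed auto

theorem sdim_matching_join: "sdim G = card (pverts G) - 2"
  unfolding sdim_def
proof (rule Least_equality)
  obtain x y where xy: "x \<in> pverts G" "y \<in> pverts G" "side x = True" "side y = False"
    using exists_on_side_avoiding by metis
  then have "x \<noteq> y" by auto
  with xy have "card (pverts G - {x, y}) = card (pverts G) - 2"
    by (simp add: card_Diff_subset)
  moreover have "strong_resolving_set G (pverts G - {x, y})"
    using strong_resolving_set_Diff xy by simp
  ultimately show "\<exists>S. finite S \<and> strong_resolving_set G S \<and> card S = card (pverts G) - 2"
    using finite_verts by blast
next
  fix k assume "\<exists>S. finite S \<and> strong_resolving_set G S \<and> card S = k"
  then show "card (pverts G) - 2 \<le> k" using card_strong_resolving_set_ge by blast
qed

end


section \<open>Coordinates on the dihedral group\<close>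

text \<open>The pair \<open>(i, s)\<close> stands for \<open>a\<^sup>i b\<^sup>s\<close>; this model shows that the presentation does not collapse.\<close>

definition dih_mult :: "nat \<Rightarrow> int \<times> bool \<Rightarrow> int \<times> bool \<Rightarrow> int \<times> bool" where
  "dih_mult n p q =
     ((fst p + (if snd p then - fst q else fst q)) mod int n, snd p \<noteq> snd q)"

text \<open>Letters act by left multiplication: \<open>b\<close> turns \<open>a^i b^s\<close> into
  \<open>a^(-i) b^(1-s)\<close>. Both signs of \<open>b\<close> act alike because \<open>b\<close>
  is an involution.\<close>

fun word_coord :: "nat \<Rightarrow> dihedral_gen word \<Rightarrow> int \<times> bool" where
  "word_coord n [] = (0, False)"
| "word_coord n ((Gen_a, e) # w) =
     ((fst (word_coord n w) + (if e then 1 else - 1)) mod int n, snd (word_coord n w))"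
| "word_coord n ((Gen_b, e) # w) = (- fst (word_coord n w) mod int n, \<not> snd (word_coord n w))"

text \<open>The chosen representative is immaterial for \<open>n > 0\<close>, since congruent words
  then have equal coordinates.\<close>

definition dih_coord :: "nat \<Rightarrow> dihedral_gen word set \<Rightarrow> int \<times> bool" where
  "dih_coord n x = word_coord n (SOME w. w \<in> x)"

section \<open>The model satisfies the relations\<close>

lemma fst_word_coord_mod [simp]: "fst (word_coord n w) mod int n = fst (word_coord n w)"
  by (induction n w rule: word_coord.induct) auto

lemma word_coord_append:
  "word_coord n (u @ v) = dih_mult n (word_coord n u) (word_coord n v)"
proof (induction n u rule: word_coord.induct)
  case (3 n e w)
  have "(- x - y) mod int n = (- y - x) mod int n" for x y :: int
    by (rule arg_cong[where f = "\<lambda>i. i mod int n"]) linarith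
  then show ?case using 3 by (auto simp: dih_mult_def mod_simps)
qed (auto simp: dih_mult_def mod_simps algebra_simps)

lemma word_coord_replicate_a:
  "word_coord n (replicate k (Gen_a, True)) = (int k mod int n, False)"
  by (induction k) (auto simp: mod_simps algebra_simps)

text \<open>It suffices to check the three relations and free cancellation; closure under contexts
  follows from \<open>word_coord_append\<close>.\<close>

lemma word_coord_cong:
  assumes "n > 0" "pres_eq (dihedral_relations n) u v"
  shows "word_coord n u = word_coord n v"
  using assms(2)
proof (induction rule: pres_eq.induct)
  case (relation u v)
  \<comment> \<open>By \<open>n > 0\<close>, \<open>int (n - 1)\<close> is \<open>int n - 1\<close>,
    so that \<open>a^(n-1)\<close> has exponent -1 modulo \<open>n\<close>, as the relation for
    \<open>ba\<close> requires.\<close>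
  with assms(1) show ?case
    by (auto simp: dihedral_relations_def word_coord_replicate_a word_coord_append dih_mult_def
        mod_simps of_nat_diff zmod_minus1)
next
  case (cancel g e)
  show ?case by (cases g) (auto simp: mod_simps)
qed (auto simp: word_coord_append)

section \<open>The presented group and its normal form\<close>

context
  fixes n :: nat
  assumes n_pos: "n > 0"
begin

interpretation D: group "dihedral n"
  unfolding dihedral_def by (rule group_presented_group)

private abbreviation cls :: "dihedral_gen word \<Rightarrow> dihedral_gen word set" where
  "cls \<equiv> pres_class (dihedral_relations n)"
private abbreviation A :: "dihedral_gen word set" where "A \<equiv> dihedral_a n"
private abbreviation B :: "dihedral_gen word set" where "B \<equiv> dihedral_b n"

lemma carrier_dihedral: "carrier (dihedral n) = range cls"
  by (simp add: dihedral_def carrier_presented_group)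

lemma mult_dihedral: "cls u \<otimes>\<^bsub>dihedral n\<^esub> cls v = cls (u @ v)"
  by (simp add: dihedral_def mult_presented_group)

lemma one_dihedral: "\<one>\<^bsub>dihedral n\<^esub> = cls []"
  by (simp add: dihedral_def one_presented_group)

lemma dihedral_gens_closed [simp]: "A \<in> carrier (dihedral n)" "B \<in> carrier (dihedral n)"
  by (auto simp: carrier_dihedral dihedral_a_def dihedral_b_def)

lemma dih_coord_class: "dih_coord n (cls w) = word_coord n w"
proof -
  have "w \<in> cls w" by (simp add: pres_class_def pres_rel_def pres_eq.refl)
  then have "(SOME u. u \<in> cls w) \<in> cls w" by (rule someI)
  then show ?thesis using word_coord_cong[OF n_pos]
    by (auto simp: dih_coord_def pres_class_def pres_rel_def)
qed

lemma dih_coord_mult: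
  assumes "x \<in> carrier (dihedral n)" "y \<in> carrier (dihedral n)"
  shows "dih_coord n (x \<otimes>\<^bsub>dihedral n\<^esub> y) = dih_mult n (dih_coord n x) (dih_coord n y)"
  using assms by (auto simp: carrier_dihedral mult_dihedral dih_coord_class word_coord_append)

lemma dihedral_a_pow: "A [^]\<^bsub>dihedral n\<^esub> k = cls (concat (replicate k word_a))"
proof (induction k)
  case (Suc k)
  have "concat (replicate k word_a) @ word_a = concat (replicate (Suc k) word_a)"
    by (induction k) auto
  with Suc show ?case by (simp add: dihedral_a_def mult_dihedral)
qed (simp add: one_dihedral)

lemma dih_coord_a_pow: "dih_coord n (A [^]\<^bsub>dihedral n\<^esub> (k::nat)) = (int k mod int n, False)"
  by (simp add: dihedral_a_pow dih_coord_class word_coord_replicate_a)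

lemma dih_coord_one: "dih_coord n \<one>\<^bsub>dihedral n\<^esub> = (0, False)"
  by (simp add: one_dihedral dih_coord_class)

lemma dih_coord_b: "dih_coord n B = (0, True)"
  by (simp add: dihedral_b_def dih_coord_class)

lemma dihedral_a_pow_n: "A [^]\<^bsub>dihedral n\<^esub> n = \<one>\<^bsub>dihedral n\<^esub>"
  by (auto simp: dihedral_a_pow one_dihedral pres_class_eq_iff dihedral_relations_def
      intro: pres_eq.relation)

lemma dihedral_b_b: "B \<otimes>\<^bsub>dihedral n\<^esub> B = \<one>\<^bsub>dihedral n\<^esub>"
  unfolding dihedral_b_def mult_dihedral one_dihedral pres_class_eq_iff
  by (rule pres_eq.relation) (simp add: dihedral_relations_def)

lemma dihedral_b_a: "B \<otimes>\<^bsub>dihedral n\<^esub> A = A [^]\<^bsub>dihedral n\<^esub> (n - 1) \<otimes>\<^bsub>dihedral n\<^esub> B"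
  unfolding dihedral_a_pow
  unfolding dihedral_b_def dihedral_a_def mult_dihedral pres_class_eq_iff
  by (rule pres_eq.relation) (simp add: dihedral_relations_def)

text \<open>Moving \<open>b\<close> past one \<open>a\<close> costs \<open>n - 1\<close> further
  factors; the natural number \<open>(n - 1) * k\<close> plays the role of the exponent
  \<open>-k\<close>.\<close>

lemma dihedral_b_a_pow:
  "B \<otimes>\<^bsub>dihedral n\<^esub> A [^]\<^bsub>dihedral n\<^esub> (k::nat) =
   A [^]\<^bsub>dihedral n\<^esub> ((n - 1) * k) \<otimes>\<^bsub>dihedral n\<^esub> B"
proof (induction k)
  case (Suc k)
  have "B \<otimes>\<^bsub>dihedral n\<^esub> A [^]\<^bsub>dihedral n\<^esub> Suc k =
        (B \<otimes>\<^bsub>dihedral n\<^esub> A [^]\<^bsub>dihedral n\<^esub> k) \<otimes>\<^bsub>dihedral n\<^esub> A"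
    by (simp add: D.m_assoc)
  also have "\<dots> = A [^]\<^bsub>dihedral n\<^esub> ((n - 1) * k) \<otimes>\<^bsub>dihedral n\<^esub> (B \<otimes>\<^bsub>dihedral n\<^esub> A)"
    by (simp add: Suc D.m_assoc)
  also have "\<dots> = A [^]\<^bsub>dihedral n\<^esub> ((n - 1) * k + (n - 1)) \<otimes>\<^bsub>dihedral n\<^esub> B"
    unfolding dihedral_b_a by (simp add: D.m_assoc [symmetric] D.nat_pow_mult)
  finally show ?case by (simp add: add.commute)
qed simp

text \<open>Replaces inverse letters by positive powers, so that natural exponents suffice in the
  normal form. Each equation cancels the generator from two expressions for the identity.\<close>

lemma class_gen_inverse:
  "cls [(Gen_a, False)] = A [^]\<^bsub>dihedral n\<^esub> (n - 1)" "cls [(Gen_b, False)] = B"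
proof -
  have closed: "cls w \<in> carrier (dihedral n)" for w by (simp add: carrier_dihedral)
  have inverse: "cls [(g, True)] \<otimes>\<^bsub>dihedral n\<^esub> cls [(g, False)] = \<one>\<^bsub>dihedral n\<^esub>" for g
    using pres_eq.cancel[of "dihedral_relations n" g True]
    by (simp add: mult_dihedral one_dihedral pres_class_eq_iff)
  have "A \<otimes>\<^bsub>dihedral n\<^esub> A [^]\<^bsub>dihedral n\<^esub> (n - 1) = A [^]\<^bsub>dihedral n\<^esub> n"
    using D.nat_pow_mult[of A 1 "n - 1"] n_pos by simp
  then have "A \<otimes>\<^bsub>dihedral n\<^esub> A [^]\<^bsub>dihedral n\<^esub> (n - 1) =
      A \<otimes>\<^bsub>dihedral n\<^esub> cls [(Gen_a, False)]"
    using inverse[of Gen_a] by (simp add: dihedral_a_pow_n) (simp add: dihedral_a_def)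
  then show "cls [(Gen_a, False)] = A [^]\<^bsub>dihedral n\<^esub> (n - 1)"
    using closed D.Units_l_cancel D.Units_eq by (metis D.nat_pow_closed dihedral_gens_closed(1))
  have "B \<otimes>\<^bsub>dihedral n\<^esub> B = B \<otimes>\<^bsub>dihedral n\<^esub> cls [(Gen_b, False)]"
    using inverse[of Gen_b] by (simp add: dihedral_b_b) (simp add: dihedral_b_def)
  then show "cls [(Gen_b, False)] = B"
    using closed D.Units_l_cancel D.Units_eq by (metis dihedral_gens_closed(2))
qed

text \<open>Prepending a power of \<open>a\<close> adds to the exponent; prepending \<open>b\<close>
  moves it past \<open>a^i\<close> and toggles \<open>s\<close> by \<open>b b = 1\<close>. The
  exponent is reduced below \<open>n\<close> only in the next lemma.\<close>

lemma class_normal_form: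
  "\<exists>i s. cls w = A [^]\<^bsub>dihedral n\<^esub> (i::nat) \<otimes>\<^bsub>dihedral n\<^esub> (if s then B else \<one>\<^bsub>dihedral n\<^esub>)"
proof (induction w)
  case Nil
  show ?case by (intro exI[of _ 0] exI[of _ False]) (simp add: one_dihedral [symmetric])
next
  case (Cons l w)
  obtain i s where
    w: "cls w = A [^]\<^bsub>dihedral n\<^esub> (i::nat) \<otimes>\<^bsub>dihedral n\<^esub> (if s then B else \<one>\<^bsub>dihedral n\<^esub>)"
    using Cons by blast
  have split: "cls (l # w) = cls [l] \<otimes>\<^bsub>dihedral n\<^esub> cls w" by (simp add: mult_dihedral)
  have "(\<exists>k::nat. cls [l] = A [^]\<^bsub>dihedral n\<^esub> k) \<or> cls [l] = B"
  proof -
    have "cls word_a = A [^]\<^bsub>dihedral n\<^esub> (1::nat)" "cls word_b = B"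
      by (simp, simp add: dihedral_a_def) (simp add: dihedral_b_def)
    with class_gen_inverse show ?thesis
      by (metis (full_types) dihedral_gen.exhaust surj_pair)
  qed
  then show ?case
  proof (elim disjE exE)
    fix k :: nat assume "cls [l] = A [^]\<^bsub>dihedral n\<^esub> k"
    then have "cls (l # w) =
        A [^]\<^bsub>dihedral n\<^esub> (k + i) \<otimes>\<^bsub>dihedral n\<^esub> (if s then B else \<one>\<^bsub>dihedral n\<^esub>)"
      unfolding split w by (simp add: D.m_assoc [symmetric] D.nat_pow_mult)
    then show ?thesis by blast
  next
    assume "cls [l] = B"
    then have "cls (l # w) = (B \<otimes>\<^bsub>dihedral n\<^esub> A [^]\<^bsub>dihedral n\<^esub> i) \<otimes>\<^bsub>dihedral n\<^esub>
        (if s then B else \<one>\<^bsub>dihedral n\<^esub>)"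
      unfolding split w by (simp add: D.m_assoc)
    also have "\<dots> = A [^]\<^bsub>dihedral n\<^esub> ((n - 1) * i) \<otimes>\<^bsub>dihedral n\<^esub>
        (if \<not> s then B else \<one>\<^bsub>dihedral n\<^esub>)"
      unfolding dihedral_b_a_pow by (simp add: D.m_assoc dihedral_b_b)
    finally show ?thesis by blast
  qed
qed

lemma dihedral_normal_form:
  assumes "x \<in> carrier (dihedral n)"
  obtains i s where "i < n"
    "x = A [^]\<^bsub>dihedral n\<^esub> (i::nat) \<otimes>\<^bsub>dihedral n\<^esub> (if s then B else \<one>\<^bsub>dihedral n\<^esub>)"
proof -
  obtain i s where
    x: "x = A [^]\<^bsub>dihedral n\<^esub> (i::nat) \<otimes>\<^bsub>dihedral n\<^esub> (if s then B else \<one>\<^bsub>dihedral n\<^esub>)"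
    using assms class_normal_form unfolding carrier_dihedral by blast
  have "A [^]\<^bsub>dihedral n\<^esub> i = A [^]\<^bsub>dihedral n\<^esub> (n * (i div n) + i mod n)" by simp
  also have "\<dots> = (A [^]\<^bsub>dihedral n\<^esub> n) [^]\<^bsub>dihedral n\<^esub> (i div n) \<otimes>\<^bsub>dihedral n\<^esub>
      A [^]\<^bsub>dihedral n\<^esub> (i mod n)"
    by (simp only: D.nat_pow_mult [symmetric] D.nat_pow_pow dihedral_gens_closed)
  finally have "A [^]\<^bsub>dihedral n\<^esub> i = A [^]\<^bsub>dihedral n\<^esub> (i mod n)"
    by (simp add: dihedral_a_pow_n)
  with x n_pos that[of "i mod n" s] show ?thesis by simp
qed

text \<open>Reduction modulo \<open>n\<close> fixes \<open>i < n\<close>, so exponent and flag can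
  be read off; hence distinct normal forms are distinct elements.\<close>

lemma dih_coord_normal_form:
  assumes "i < n"
  shows "dih_coord n (A [^]\<^bsub>dihedral n\<^esub> i \<otimes>\<^bsub>dihedral n\<^esub>
    (if s then B else \<one>\<^bsub>dihedral n\<^esub>)) = (int i, s)"
  using assms by (auto simp: dih_coord_mult dih_coord_a_pow dih_coord_b dih_mult_def
      dih_coord_one)

section \<open>Counting rotations and reflections\<close>

lemma bij_betw_dih_coord:
  "bij_betw (dih_coord n) (carrier (dihedral n)) ({0..<int n} \<times> UNIV)"
proof (rule bij_betw_imageI)
  show "inj_on (dih_coord n) (carrier (dihedral n))"
  proof (rule inj_onI)
    fix x y assume "x \<in> carrier (dihedral n)" "y \<in> carrier (dihedral n)"
      "dih_coord n x = dih_coord n y"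
    \<comment> \<open>Both elements have normal forms, and equal coordinates make these normal forms
      coincide.\<close>
    then show "x = y"
      by (metis dihedral_normal_form dih_coord_normal_form of_nat_eq_iff prod.inject)
  qed
  show "dih_coord n ` carrier (dihedral n) = {0..<int n} \<times> UNIV"
  proof (intro equalityI subsetI)
    fix p assume "p \<in> dih_coord n ` carrier (dihedral n)"
    then obtain x where "x \<in> carrier (dihedral n)" "p = dih_coord n x" by blast
    then show "p \<in> {0..<int n} \<times> UNIV"
      by (elim dihedral_normal_form) (simp only: dih_coord_normal_form, simp)
  next
    fix p assume "p \<in> {0..<int n} \<times> (UNIV :: bool set)"
    then obtain i s where "p = (int i, s)" "i < n"
      by (cases p) (auto elim!: nonneg_int_cases)
    then show "p \<in> dih_coord n ` carrier (dihedral n)"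
      by (intro image_eqI[of _ _ "A [^]\<^bsub>dihedral n\<^esub> i \<otimes>\<^bsub>dihedral n\<^esub>
            (if s then B else \<one>\<^bsub>dihedral n\<^esub>)"]) (simp_all only: dih_coord_normal_form, simp)
  qed
qed

lemma card_dih_coord_snd: "card {x \<in> carrier (dihedral n). snd (dih_coord n x) = s} = n"
proof -
  have "{x \<in> carrier (dihedral n). snd (dih_coord n x) = s} \<subseteq> carrier (dihedral n)" by auto
  moreover have "dih_coord n ` {x \<in> carrier (dihedral n). snd (dih_coord n x) = s} =
      {p \<in> dih_coord n ` carrier (dihedral n). snd p = s}" by auto
  then have "dih_coord n ` {x \<in> carrier (dihedral n). snd (dih_coord n x) = s} =
      {0..<int n} \<times> {s}"
    using bij_betw_imp_surj_on[OF bij_betw_dih_coord] by auto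
  ultimately have "bij_betw (dih_coord n) {x \<in> carrier (dihedral n). snd (dih_coord n x) = s}
      ({0..<int n} \<times> {s})"
    by (rule bij_betw_subset[OF bij_betw_dih_coord])
  then show ?thesis by (simp add: bij_betw_same_card card_cartesian_product)
qed

lemma card_dihedral: "card (carrier (dihedral n)) = 2 * n"
  using bij_betw_same_card[OF bij_betw_dih_coord] by (simp add: card_cartesian_product)

section \<open>The Cayley graph as a join of two matchings\<close>

lemma Psi_eq:
  "Psi n = {x \<in> carrier (dihedral n). snd (dih_coord n x)} \<union> {A [^]\<^bsub>dihedral n\<^esub> (n div 2)}"
proof -
  have "x \<in> Psi n" if closed: "x \<in> carrier (dihedral n)" and reflection: "snd (dih_coord n x)" for x
  proof -
    obtain i s where
      x: "i < n" "x = A [^]\<^bsub>dihedral n\<^esub> (i::nat) \<otimes>\<^bsub>dihedral n\<^esub> (if s then B else \<one>\<^bsub>dihedral n\<^esub>)"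
      using closed by (rule dihedral_normal_form)
    with reflection have s: "s" by (simp add: dih_coord_normal_form)
    show ?thesis
    \<comment> \<open>The exponents in \<open>Psi\<close> start at 1, and \<open>b\<close> is listed
      separately.\<close>
    proof (cases "i = 0")
      case True
      with x s show ?thesis by (simp add: Psi_def)
    next
      case False
      with x(1) have "1 \<le> i" "i \<le> n - 1" by auto
      with x(2) s show ?thesis by (auto simp: Psi_def)
    qed
  qed
  then show ?thesis
    by (auto simp: Psi_def dih_coord_mult dih_coord_a_pow dih_coord_b dih_mult_def)
qed

text \<open>The second coordinate is a homomorphism to the group of order 2, with
  \<open>\<noteq>\<close> as addition. Applying it to \<open>y = x (x^(-1) y)\<close> avoids
  computing coordinates of an inverse.\<close>

lemma snd_dih_coord_inv_mult:
  assumes "x \<in> carrier (dihedral n)" "y \<in> carrier (dihedral n)"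
  shows "snd (dih_coord n (inv\<^bsub>dihedral n\<^esub> x \<otimes>\<^bsub>dihedral n\<^esub> y)) \<longleftrightarrow>
    snd (dih_coord n x) \<noteq> snd (dih_coord n y)"
proof -
  have "snd (dih_coord n y) =
      snd (dih_coord n (x \<otimes>\<^bsub>dihedral n\<^esub> (inv\<^bsub>dihedral n\<^esub> x \<otimes>\<^bsub>dihedral n\<^esub> y)))"
    using assms by (simp add: D.m_assoc [symmetric])
  also have "\<dots> \<longleftrightarrow>
      snd (dih_coord n x) \<noteq> snd (dih_coord n (inv\<^bsub>dihedral n\<^esub> x \<otimes>\<^bsub>dihedral n\<^esub> y))"
    using assms dih_coord_mult[of x "inv\<^bsub>dihedral n\<^esub> x \<otimes>\<^bsub>dihedral n\<^esub> y"]
    by (simp add: dih_mult_def)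
  finally show ?thesis by blast
qed

lemma matching_join_cayley_graph:
  assumes "n \<ge> 3" "even n"
  shows "matching_join (cayley_graph (dihedral n) (Psi n)) (\<lambda>x. snd (dih_coord n x))
    (\<lambda>x. x \<otimes>\<^bsub>dihedral n\<^esub> A [^]\<^bsub>dihedral n\<^esub> (n div 2))"
proof
  show "finite (pverts (cayley_graph (dihedral n) (Psi n)))"
    using card_dihedral n_pos by (simp add: cayley_graph_def card_ge_0_finite)
next
  fix x y
  assume "x \<in> pverts (cayley_graph (dihedral n) (Psi n))"
    "y \<in> pverts (cayley_graph (dihedral n) (Psi n))"
  then have xy: "x \<in> carrier (dihedral n)" "y \<in> carrier (dihedral n)"
    by (auto simp: cayley_graph_def)
  \<comment> \<open>The single rotation in \<open>Psi\<close> contributes the mate arcs; the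
    reflections contribute exactly the arcs between the sides.\<close>
  then have "inv\<^bsub>dihedral n\<^esub> x \<otimes>\<^bsub>dihedral n\<^esub> y = A [^]\<^bsub>dihedral n\<^esub> (n div 2) \<longleftrightarrow>
      y = x \<otimes>\<^bsub>dihedral n\<^esub> A [^]\<^bsub>dihedral n\<^esub> (n div 2)"
    using D.inv_solve_left' by auto
  with xy snd_dih_coord_inv_mult[OF xy]
  show "(x, y) \<in> parcs (cayley_graph (dihedral n) (Psi n)) \<longleftrightarrow>
      snd (dih_coord n x) \<noteq> snd (dih_coord n y) \<or>
      y = x \<otimes>\<^bsub>dihedral n\<^esub> A [^]\<^bsub>dihedral n\<^esub> (n div 2)"
    by (auto simp: cayley_graph_def Psi_eq)
next
  fix x assume "x \<in> pverts (cayley_graph (dihedral n) (Psi n))"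
  \<comment> \<open>Evenness makes the square of \<open>a^(n div 2)\<close> equal to
    \<open>a^n = 1\<close>, so that \<open>mate\<close> is an involution.\<close>
  moreover have "n div 2 + n div 2 = n" using assms(2) by presburger
  ultimately show "x \<otimes>\<^bsub>dihedral n\<^esub> A [^]\<^bsub>dihedral n\<^esub> (n div 2) \<otimes>\<^bsub>dihedral n\<^esub>
      A [^]\<^bsub>dihedral n\<^esub> (n div 2) = x"
    by (simp add: cayley_graph_def D.m_assoc D.nat_pow_mult dihedral_a_pow_n)
next
  fix s
  show "3 \<le> card {x \<in> pverts (cayley_graph (dihedral n) (Psi n)). snd (dih_coord n x) = s}"
    using card_dih_coord_snd[of s] assms(1) by (simp add: cayley_graph_def)
qed

end

theorem theorem3p8:
  fixes n :: nat
  assumes "n \<ge> 4" and "even n"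
  shows "sdim (cayley_graph (dihedral n) (Psi n)) = 2 * n - 2"
proof -
  have n: "n > 0" "n \<ge> 3" using assms(1) by auto
  show ?thesis
    using matching_join.sdim_matching_join[OF matching_join_cayley_graph[OF n assms(2)]]
      card_dihedral[OF n(1)]
    by (simp add: cayley_graph_def)
qed

end
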